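(* Let $\Sigma=(\mathcal A,\mathcal A_1,\mathcal G,E,X,U,h)$ be a dt-SNPS-td with initial set $X_a\subset X$ and unsafe set $X_b\subset X$, $X_a\cap X_b=\emptyset$, and let $\mathcal T\in\mathbb N$. Assume there exist a K-QCBC $\mathcal B$ for $\Sigma$ with constants $\eta,\gamma_a,\gamma_b\in\mathbb R^+$, $\gamma_b>\gamma_a$, and a control policy $u(\cdot)$, with values in $U$, which realizes the third K-QCBC condition, i.e. $\mathbb E[\mathcal B(\mathbf x_{k+1})\mid \mathbf x_k,u_k]-\mathcal B(\mathbf x_k)\le\eta$ for every $\mathbf x_k\in X^{h+1}$ when $u_k$ is the input chosen by the policy at $\mathbf x_k$. Then for any initial history $\mathbf x_0\in X_a^{h+1}$, the solution process $\mathbf x_{\mathbf x_0uw}$ of $\Sigma$ under $u(\cdot)$ and the process noise $w(\cdot)$ satisfies $$\mathbb P\Big\{\mathbf x_{\mathbf x_0uw}(k)\notin X_b\times(X\setminus X_b)^h\ \text{ for all } k\in\{1,\dots,\mathcal T\}\ \Big|\ \mathbf x_0\Big\}\ \ge\ 1-\mu_h,\qquad \mu_h=\frac{\gamma_a+\eta\mathcal T}{\gamma_b}.$$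
   Context: $\mathbb R^+$ and $\mathbb R_0^+$ denote the positive and nonnegative reals. A discrete-time stochastic nonlinear polynomial system with time-invariant delay (dt-SNPS-td) $\Sigma=(\mathcal A,\mathcal A_1,\mathcal G,E,X,U,h)$ is $$x_{k+1}=A(x_k,x_{k-h})x_k+A_1(x_k,x_{k-h})x_{k-h}+G(x_k,x_{k-h})u_k+Ew_k,\quad k\in\mathbb N,$$ where $h\in\mathbb N^+$ is the delay; $x_k,x_{k-h}\in X$ with $X\subseteq\mathbb R^n$ Borel (the state set); $u_k\in U=\{u\in\mathbb R^m\mid b_j^\top u\le1,\ j=1,\dots,J\}$, $b_j\in\mathbb R^m$; $(w_k)$ are i.i.d. with standard normal distribution $\mathcal N(\mathbf 0,\mathbf I_n)$; $\mathcal A=A(\cdot,\cdot)\in\mathbb R^{n\times n}$, $\mathcal A_1=A_1(\cdot,\cdot)\in\mathbb R^{n\times n}$, $\mathcal G=G(\cdot,\cdot)\in\mathbb R^{n\times m}$ are polynomial matrices and $E\in\mathbb R^{n\times n}$ is constant. The state history at time $k$ is $\mathbf x_k=(x_k,x_{k-1},\dots,x_{k-h})\in X^{h+1}$, its successor is $\mathbf x_{k+1}=(x_{k+1},x_k,\dots,x_{k-h+1})$; a generic history is written $\mathbf x=(x,x_1,\dots,x_h)$. The solution process $\mathbf x_{\mathbf x_0uw}(k)$ is the state of $\Sigma$ at time $k$ together with its $h$-step history (i.e. $\mathbf x_k$), under input $u(\cdot)$ and noise $w(\cdot)$, started from the initial history $\mathbf x_0=(x_0,\dots,x_{-h})$.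 A Krasovskii quadratic control barrier certificate (K-QCBC) for $\Sigma$ with constants $\eta,\gamma_a,\gamma_b\in\mathbb R^+$, $\gamma_b>\gamma_a$, is a function $\mathcal B:X^{h+1}\to\mathbb R_0^+$ of the form $\mathcal B(\mathbf x)=x^\top Px+\sum_{i=1}^h x_i^\top P_1x_i$ (with $P,P_1\in\mathbb R^{n\times n}$) such that (1) $\mathcal B(\mathbf x)\le\gamma_a$ for all $\mathbf x\in X_a^{h+1}$; (2) $\mathcal B(\mathbf x)\ge\gamma_b$ for all $\mathbf x\in X_b\times(X\setminus X_b)^h$; (3) for all $\mathbf x_k\in X^{h+1}$ there exists $u_k\in U$ such that $\mathbb E[\mathcal B(\mathbf x_{k+1})\mid\mathbf x_k,u_k]-\mathcal B(\mathbf x_k)\le\eta$. *)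

theory Defs
  imports "HOL-Probability.Probability"
begin

record ('n::finite, 'm::finite) delay_system =
  mat_A :: "real^'n \<Rightarrow> real^'n \<Rightarrow> real^'n^'n"
  mat_A1 :: "real^'n \<Rightarrow> real^'n \<Rightarrow> real^'n^'n"
  mat_G :: "real^'n \<Rightarrow> real^'n \<Rightarrow> real^'m^'n"
  mat_E :: "real^'n^'n"
  state_set :: "(real^'n) set"
  input_set :: "(real^'m) set"
  delay :: nat

definition dt_SNPS_td :: "('n::finite, 'm::finite) delay_system \<Rightarrow> bool" where
  "dt_SNPS_td S \<longleftrightarrow>
     polynomial_function (\<lambda>(x, y). mat_A S x y) \<and>
     polynomial_function (\<lambda>(x, y). mat_A1 S x y) \<and>
     polynomial_function (\<lambda>(x, y). mat_G S x y) \<and>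
     state_set S \<in> sets borel \<and>
     (\<exists>J (b :: nat \<Rightarrow> real^'m). input_set S = {u. \<forall>j\<in>{1..J}. b j \<bullet> u \<le> 1}) \<and>
     1 \<le> delay S"

text \<open>A history $(x, x_1, \dots, x_h)$ is a function on the indices $0, \dots, h$ (and
  undefined elsewhere): index 0 holds the current state, index $i$ the state $i$ steps ago.\<close>

type_synonym 'n history = "nat \<Rightarrow> real^'n"

definition histories :: "nat \<Rightarrow> (real^'n::finite) set \<Rightarrow> 'n history set" where
  "histories h Y = ({..h} \<rightarrow>\<^sub>E Y)"

definition unsafe_histories ::
    "('n::finite, 'm::finite) delay_system \<Rightarrow> (real^'n) set \<Rightarrow> 'n history set" where
  "unsafe_histories S Xb =
     (\<Pi>\<^sub>E i\<in>{..delay S}. if i = 0 then Xb else state_set S - Xb)"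

definition next_state ::
    "('n::finite, 'm::finite) delay_system \<Rightarrow> 'n history \<Rightarrow> real^'m \<Rightarrow> real^'n \<Rightarrow> real^'n" where
  "next_state S \<xi> u v =
     (let x = \<xi> 0; xh = \<xi> (delay S)
      in mat_A S x xh *v x + mat_A1 S x xh *v xh + mat_G S x xh *v u + mat_E S *v v)"

definition next_history ::
    "('n::finite, 'm::finite) delay_system \<Rightarrow> 'n history \<Rightarrow> real^'m \<Rightarrow> real^'n \<Rightarrow> 'n history" where
  "next_history S \<xi> u v =
     (\<lambda>i\<in>{..delay S}. if i = 0 then next_state S \<xi> u v else \<xi> (i - 1))"

definition std_normal_vec :: "(real^'n::finite) measure" where
  "std_normal_vec = density lborel (\<lambda>v. ennreal (\<Prod>i\<in>UNIV. std_normal_density (v $ i)))"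

definition std_normal_noise :: "'w measure \<Rightarrow> (nat \<Rightarrow> 'w \<Rightarrow> real^'n::finite) \<Rightarrow> bool" where
  "std_normal_noise M w \<longleftrightarrow>
     prob_space.indep_vars M (\<lambda>_. borel) w UNIV \<and>
     (\<forall>k. distr M borel (w k) = std_normal_vec)"

text \<open>A policy is a measurable feedback from $X^{h+1}$ to $U$, possibly depending on the
  time $k$. It is undefined, hence constant, outside $X^{h+1}$.\<close>

definition control_policy ::
    "('n::finite, 'm::finite) delay_system \<Rightarrow> (nat \<Rightarrow> 'n history \<Rightarrow> real^'m) \<Rightarrow> bool" where
  "control_policy S u \<longleftrightarrow>
     (\<forall>k. u k \<in> histories (delay S) (state_set S) \<rightarrow>\<^sub>E input_set S \<and>
          u k \<in> restrict_space (\<Pi>\<^sub>M i\<in>{..delay S}. borel) (histories (delay S) (state_set S))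
                \<rightarrow>\<^sub>M borel)"

primrec solution ::
    "('n::finite, 'm::finite) delay_system \<Rightarrow> 'n history \<Rightarrow> (nat \<Rightarrow> 'n history \<Rightarrow> real^'m) \<Rightarrow>
     (nat \<Rightarrow> 'w \<Rightarrow> real^'n) \<Rightarrow> nat \<Rightarrow> 'w \<Rightarrow> 'n history" where
  "solution S x0 u w 0 \<omega> = x0"
| "solution S x0 u w (Suc k) \<omega> =
     next_history S (solution S x0 u w k \<omega>) (u k (solution S x0 u w k \<omega>)) (w k \<omega>)"

definition krasovskii_form ::
    "nat \<Rightarrow> real^'n^'n \<Rightarrow> real^'n^'n \<Rightarrow> 'n::finite history \<Rightarrow> real" where
  "krasovskii_form h P P1 \<xi> = \<xi> 0 \<bullet> (P *v \<xi> 0) + (\<Sum>i=1..h. \<xi> i \<bullet> (P1 *v \<xi> i))"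

text \<open>The conditional expectation of $B(\mathbf x_{k+1})$ given the values
  $\mathbf x_k = \xi$ and $u_k = u$, that is, over the noise $w_k$ alone.\<close>

definition expected_next ::
    "('n::finite, 'm::finite) delay_system \<Rightarrow> ('n history \<Rightarrow> real) \<Rightarrow> 'n history \<Rightarrow> real^'m \<Rightarrow> real" where
  "expected_next S B \<xi> u = (\<integral>v. B (next_history S \<xi> u v) \<partial>std_normal_vec)"

text \<open>The quadratic formula defines $B$ on all histories, so that the expectation above makes
  sense even if the noise can lead from some history outside the state set; nonnegativity is
  required on $X^{h+1}$ only.\<close>

definition K_QCBC ::
    "('n::finite, 'm::finite) delay_system \<Rightarrow> (real^'n) set \<Rightarrow> (real^'n) set \<Rightarrow>
     real \<Rightarrow> real \<Rightarrow> real \<Rightarrow> ('n history \<Rightarrow> real) \<Rightarrow> bool" where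
  "K_QCBC S Xa Xb \<eta> \<gamma>a \<gamma>b B \<longleftrightarrow>
     0 < \<eta> \<and> 0 < \<gamma>a \<and> 0 < \<gamma>b \<and> \<gamma>a < \<gamma>b \<and>
     (\<exists>P P1. B = krasovskii_form (delay S) P P1) \<and>
     (\<forall>\<xi>\<in>histories (delay S) (state_set S). 0 \<le> B \<xi>) \<and>
     (\<forall>\<xi>\<in>histories (delay S) Xa. B \<xi> \<le> \<gamma>a) \<and>
     (\<forall>\<xi>\<in>unsafe_histories S Xb. \<gamma>b \<le> B \<xi>) \<and>
     (\<forall>\<xi>\<in>histories (delay S) (state_set S). \<exists>u\<in>input_set S.
        expected_next S B \<xi> u - B \<xi> \<le> \<eta>)"

end

theory Submission
  imports Defs
begin

text \<open>Freeze the certificate at \<open>\<gamma>b\<close> from the first visit to the unsafe histories on. Since the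
  noise \<open>w k\<close> is independent of the history at time \<open>k\<close>, the expectation of this nonnegative
  stopped process grows by at most \<open>\<eta>\<close> per step, hence is at most \<open>\<gamma>a + \<eta> T\<close> at time \<open>T\<close>.
  It equals \<open>\<gamma>b\<close> once an unsafe history has been visited, so Markov's inequality bounds the
  probability of such a visit. The condition on the conditional expectation can be used because
  a quadratic function of a Gaussian vector is integrable.\<close>

section \<open>Gaussian second moments and integrability of the certificate\<close>

text \<open>Density and squared coordinate both factor over the coordinates, so Tonelli leaves a
  product of one-dimensional absolute moments: order 2 in direction \<open>j\<close>, order 0 in all
  others.\<close>

lemma std_normal_vec_moment_finite:
  fixes j :: "'n::finite"
  shows "(\<integral>\<^sup>+v. ennreal ((v $ j)\<^sup>2) \<partial>std_normal_vec) < \<infinity>"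
proof -
  \<comment> \<open>Indexing by basis vectors fits the product formula for \<open>lborel\<close> on
    a Euclidean space; the power 0 gives both branches the shape of an absolute moment.\<close>
  define f :: "real^'n \<Rightarrow> real \<Rightarrow> real" where
    "f b t = (if b = axis j 1 then std_normal_density t * \<bar>t\<bar>^2 else std_normal_density t * \<bar>t\<bar>^0)" for b t
  have f_nonneg: "0 \<le> f b t" for b t
    by (simp add: f_def)
  have f_meas [measurable]: "f b \<in> borel_measurable borel" for b
    unfolding f_def by measurable
  have f_fin: "(\<integral>\<^sup>+t. ennreal (f b t) \<partial>lborel) < \<infinity>" for b
  proof -
    have "integrable lborel (f b)"
      unfolding f_def
      using integrable_std_normal_moment_abs[of 2] integrable_std_normal_moment_abs[of 0]
      by (cases "b = axis j 1") auto
    then show ?thesis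
      by (simp add: integrable_iff_bounded f_nonneg)
  qed
  have inj: "inj_on (\<lambda>i. axis i (1::real) :: real^'n) UNIV"
    by (auto simp: inj_on_def axis_eq_axis)
  have Basis_eq: "(Basis :: (real^'n) set) = (\<lambda>i. axis i 1) ` UNIV"
    by (auto simp: Basis_vec_def)
  have density: "(\<Prod>i\<in>UNIV. std_normal_density (v $ i)) * (v $ j)\<^sup>2 = (\<Prod>b\<in>Basis. f b (v \<bullet> b))"
    for v :: "real^'n"
  proof -
    have "(\<Prod>b\<in>Basis. f b (v \<bullet> b)) = (\<Prod>i\<in>UNIV. f (axis i 1) (v $ i))"
      unfolding Basis_eq by (subst prod.reindex[OF inj]) (simp add: inner_axis)
    also have "\<dots> = (\<Prod>i\<in>UNIV. std_normal_density (v $ i) * (if i = j then (v $ i)\<^sup>2 else 1))"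
      by (intro prod.cong) (auto simp: f_def axis_eq_axis)
    also have "\<dots> = (\<Prod>i\<in>UNIV. std_normal_density (v $ i)) * (v $ j)\<^sup>2"
      by (simp add: prod.distrib)
    finally show ?thesis by simp
  qed
  have "(\<integral>\<^sup>+v. ennreal ((v $ j)\<^sup>2) \<partial>std_normal_vec)
      = (\<integral>\<^sup>+v. (\<Prod>b\<in>Basis. ennreal (f b (v \<bullet> b))) \<partial>lborel)"
    unfolding std_normal_vec_def
    by (subst nn_integral_density)
       (auto simp: ennreal_mult[symmetric] prod_nonneg density prod_ennreal f_nonneg
          intro!: nn_integral_cong)
  also have "\<dots> = (\<Prod>b\<in>Basis. (\<integral>\<^sup>+t. ennreal (f b t) \<partial>lborel))"
    by (rule nn_integral_lborel_prod) auto
  also have "\<dots> < \<infinity>"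
    using f_fin[THEN less_imp_neq] by (simp add: less_top[symmetric] ennreal_prod_eq_top)
  finally show ?thesis .
qed

lemma integrable_std_normal_vec_norm_squared:
  "integrable std_normal_vec (\<lambda>v::real^'n::finite. (norm v)\<^sup>2)"
proof -
  have "integrable std_normal_vec (\<lambda>v::real^'n. (v $ j)\<^sup>2)" for j
    using std_normal_vec_moment_finite[of j]
    by (auto simp: integrable_iff_bounded std_normal_vec_def)
  then have "integrable std_normal_vec (\<lambda>v::real^'n. \<Sum>j\<in>UNIV. (v $ j)\<^sup>2)"
    by (intro Bochner_Integration.integrable_sum)
  moreover have "(norm v)\<^sup>2 = (\<Sum>j\<in>UNIV. (v $ j)\<^sup>2)" for v :: "real^'n"
    by (simp only: power2_norm_eq_inner inner_vec_def) (simp add: power2_eq_square)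
  ultimately show ?thesis
    by simp
qed

text \<open>The noise enters the next history only at index 0, and affinely, so the form is a
  quadratic polynomial in \<open>v\<close>, dominated by a constant plus a multiple of
  \<open>(norm v)\<^sup>2\<close>. Integrability matters because \<open>expected_next\<close> is a
  Bochner integral, which defaults to 0 otherwise.\<close>

lemma integrable_krasovskii_form_next:
  fixes S :: "('n::finite, 'm::finite) delay_system"
  assumes "finite_measure (std_normal_vec :: (real^'n) measure)"
  shows "integrable std_normal_vec
           (\<lambda>v. krasovskii_form (delay S) P P1 (next_history S \<xi> a v))"
proof -
  interpret N: finite_measure "std_normal_vec :: (real^'n) measure" by fact
  \<comment> \<open>\<open>c\<close> is the noise-free successor state; \<open>r\<close> collects
    the shifted past, on which the noise has no influence.\<close>
  define c where "c = next_state S \<xi> a 0"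
  define r where "r = (\<Sum>i=1..delay S. \<xi> (i - 1) \<bullet> (P1 *v \<xi> (i - 1)))"
  have next_state: "next_state S \<xi> a v = c + mat_E S *v v" for v
    by (simp add: c_def next_state_def Let_def)
  have eq: "krasovskii_form (delay S) P P1 (next_history S \<xi> a v)
      = (c + mat_E S *v v) \<bullet> (P *v (c + mat_E S *v v)) + r" for v
    by (auto simp: krasovskii_form_def next_history_def next_state r_def intro!: sum.cong)
  obtain K where K: "0 < K" "\<And>v. norm (mat_E S *v v) \<le> norm v * K"
    using bounded_linear.pos_bounded[OF matrix_vector_mul_bounded_linear[of "mat_E S"]] by blast
  obtain L where L: "0 < L" "\<And>v. norm (P *v v) \<le> norm v * L"
    using bounded_linear.pos_bounded[OF matrix_vector_mul_bounded_linear[of P]] by blast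
  \<comment> \<open>Cauchy-Schwarz and the operator bounds \<open>K\<close>, \<open>L\<close>, then
    (a + b)^2 \<le> 2 a^2 + 2 b^2 to separate \<open>c\<close> from the noise.\<close>
  have bound: "\<bar>(c + mat_E S *v v) \<bullet> (P *v (c + mat_E S *v v))\<bar>
      \<le> 2 * L * (norm c)\<^sup>2 + 2 * L * K\<^sup>2 * (norm v)\<^sup>2" for v
  proof -
    let ?x = "c + mat_E S *v v"
    have "\<bar>?x \<bullet> (P *v ?x)\<bar> \<le> norm ?x * (norm ?x * L)"
      by (rule order_trans[OF Cauchy_Schwarz_ineq2 mult_left_mono[OF L(2)]]) simp
    also have "\<dots> = L * (norm ?x)\<^sup>2"
      by (simp add: power2_eq_square)
    also have "(norm ?x)\<^sup>2 \<le> (norm c + norm v * K)\<^sup>2"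
      by (intro power_mono order_trans[OF norm_triangle_ineq] add_left_mono K) simp
    also have "\<dots> \<le> 2 * (norm c)\<^sup>2 + 2 * (norm v * K)\<^sup>2"
      using zero_le_power2[of "norm c - norm v * K"] by (simp add: power2_sum power2_diff)
    finally show ?thesis
      using L(1) by (simp add: algebra_simps power_mult_distrib)
  qed
  have "continuous_on UNIV (\<lambda>v. (c + mat_E S *v v) \<bullet> (P *v (c + mat_E S *v v)))"
    by (intro continuous_intros linear_continuous_on_compose[OF _ matrix_vector_mul_linear])
  then have meas: "(\<lambda>v. (c + mat_E S *v v) \<bullet> (P *v (c + mat_E S *v v))) \<in> borel_measurable std_normal_vec"
    by (simp add: std_normal_vec_def borel_measurable_continuous_onI)
  have dom: "integrable std_normal_vec (\<lambda>v::real^'n. 2 * L * (norm c)\<^sup>2 + 2 * L * K\<^sup>2 * (norm v)\<^sup>2)"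
    by (intro Bochner_Integration.integrable_add N.integrable_const integrable_mult_right
        integrable_std_normal_vec_norm_squared)
  have "integrable std_normal_vec (\<lambda>v. (c + mat_E S *v v) \<bullet> (P *v (c + mat_E S *v v)))"
    by (rule Bochner_Integration.integrable_bound[OF dom meas])
       (intro AE_I2, unfold real_norm_def, rule order_trans[OF bound abs_ge_self])
  then show ?thesis
    unfolding eq by simp
qed

section \<open>Measurability of the dynamics, the certificate and the policy\<close>

lemma measurable_matrix_vector_mult [measurable (raw)]:
  fixes A :: "'a \<Rightarrow> real^'n::finite^'m::finite"
  assumes "A \<in> borel_measurable M" "v \<in> borel_measurable M"
  shows "(\<lambda>x. A x *v v x) \<in> borel_measurable M"
proof -
  have "continuous_on UNIV (\<lambda>p :: (real^'n^'m) \<times> (real^'n). fst p *v snd p)"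
    unfolding matrix_vector_mult_def by (intro continuous_intros)
  then show ?thesis
    by (intro borel_measurable_continuous_Pair[OF assms])
qed

lemma measurable_polynomial_function_Pair:
  fixes p :: "('a::euclidean_space \<times> 'b::euclidean_space) \<Rightarrow> 'c::euclidean_space"
  assumes "polynomial_function p" "f \<in> borel_measurable M" "g \<in> borel_measurable M"
  shows "(\<lambda>x. p (f x, g x)) \<in> borel_measurable M"
  by (intro borel_measurable_continuous_Pair[OF assms(2,3), of "\<lambda>x y. p (x, y)"])
     (simp add: continuous_on_polymonial_function[OF assms(1)])

lemma measurable_next_history:
  fixes S :: "('n::finite, 'm::finite) delay_system"
  assumes S: "dt_SNPS_td S"
    and \<xi>: "\<xi> \<in> M \<rightarrow>\<^sub>M (\<Pi>\<^sub>M i\<in>{..delay S}. borel)"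
    and [measurable]: "a \<in> borel_measurable M" "v \<in> borel_measurable M"
  shows "(\<lambda>x. next_history S (\<xi> x) (a x) (v x)) \<in> M \<rightarrow>\<^sub>M (\<Pi>\<^sub>M i\<in>{..delay S}. borel)"
proof -
  have comp: "(\<lambda>x. \<xi> x i) \<in> borel_measurable M" if "i \<le> delay S" for i
    using measurable_compose[OF \<xi> measurable_component_singleton[of i]] that by simp
  note [measurable] = comp[of 0, simplified] comp[of "delay S", simplified]
  have [measurable]:
    "(\<lambda>x. mat_A S (\<xi> x 0) (\<xi> x (delay S))) \<in> borel_measurable M"
    "(\<lambda>x. mat_A1 S (\<xi> x 0) (\<xi> x (delay S))) \<in> borel_measurable M"
    "(\<lambda>x. mat_G S (\<xi> x 0) (\<xi> x (delay S))) \<in> borel_measurable M"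
    using S measurable_polynomial_function_Pair[OF _ comp[of 0] comp[of "delay S"]]
    unfolding dt_SNPS_td_def by force+
  have "(\<lambda>x. next_state S (\<xi> x) (a x) (v x)) \<in> borel_measurable M"
    unfolding next_state_def Let_def by measurable
  with comp have "(\<lambda>x. if i = 0 then next_state S (\<xi> x) (a x) (v x) else \<xi> x (i - 1)) \<in> borel_measurable M"
    if "i \<le> delay S" for i
    using that by (cases "i = 0") auto
  then show ?thesis
    unfolding next_history_def by (intro measurable_restrict) auto
qed

lemma measurable_krasovskii_form:
  "krasovskii_form h P P1 \<in> borel_measurable (\<Pi>\<^sub>M i\<in>{..h}. borel)"
proof -
  have [measurable]: "(\<lambda>\<xi>::'n::finite history. \<xi> i) \<in> borel_measurable (\<Pi>\<^sub>M i\<in>{..h}. borel)"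
    if "i \<le> h" for i
    using that by (intro measurable_component_singleton) simp
  show ?thesis
    unfolding krasovskii_form_def
    by (intro borel_measurable_add borel_measurable_sum borel_measurable_inner
        measurable_matrix_vector_mult) auto
qed

lemma sets_histories [measurable]:
  "Y \<in> sets borel \<Longrightarrow> histories h Y \<in> sets (\<Pi>\<^sub>M i\<in>{..h}. borel)"
  unfolding histories_def by (intro sets_PiM_I_finite) auto

lemma sets_unsafe_histories:
  assumes "state_set S \<in> sets borel" "Xb \<in> sets borel"
  shows "unsafe_histories S Xb \<in> sets (\<Pi>\<^sub>M i\<in>{..delay S}. borel)"
  unfolding unsafe_histories_def using assms by (intro sets_PiM_I_finite) auto

text \<open>Measurability is given only on the admissible histories. These form a measurable set,
  and outside it the policy is constantly \<open>undefined\<close>, so the two pieces glue to a map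
  measurable on all histories.\<close>

lemma measurable_control_policy:
  assumes u: "control_policy S u" and X: "state_set S \<in> sets borel"
  shows "u k \<in> (\<Pi>\<^sub>M i\<in>{..delay S}. borel) \<rightarrow>\<^sub>M borel"
proof -
  let ?H = "histories (delay S) (state_set S)"
  let ?M = "\<Pi>\<^sub>M i\<in>{..delay S}. borel"
  have "(\<lambda>\<xi>. if \<xi> \<in> ?H then u k \<xi> else undefined) \<in> ?M \<rightarrow>\<^sub>M borel"
    using u X sets_histories[OF X, of "delay S"]
    by (subst measurable_If_restrict_space_iff) (auto simp: control_policy_def)
  moreover have "(\<lambda>\<xi>. if \<xi> \<in> ?H then u k \<xi> else undefined) = u k"
    using u by (auto simp: control_policy_def fun_eq_iff PiE_iff extensional_def)
  ultimately show ?thesis by simp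
qed

text \<open>Measurability is asked only of the noises before time \<open>k\<close>, so that the
  lemma also applies on the product space over \<open>{..<k}\<close>, with coordinate projections as
  noise.\<close>

lemma measurable_solution:
  assumes S: "dt_SNPS_td S" and u: "control_policy S u"
    and x0: "x0 \<in> space (\<Pi>\<^sub>M i\<in>{..delay S}. borel)"
    and w: "\<And>i. i < k \<Longrightarrow> w i \<in> borel_measurable M"
  shows "solution S x0 u w k \<in> M \<rightarrow>\<^sub>M (\<Pi>\<^sub>M i\<in>{..delay S}. borel)"
  using w
proof (induction k)
  case 0
  then show ?case using x0 by (simp add: measurable_const)
next
  case (Suc k)
  then have *: "solution S x0 u w k \<in> M \<rightarrow>\<^sub>M (\<Pi>\<^sub>M i\<in>{..delay S}. borel)"
    by simp
  moreover have "state_set S \<in> sets borel"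
    using S by (simp add: dt_SNPS_td_def)
  ultimately have "(\<lambda>\<omega>. u k (solution S x0 u w k \<omega>)) \<in> borel_measurable M"
    using measurable_compose[OF _ measurable_control_policy[OF u]] by blast
  then show ?case
    using measurable_next_history[OF S * _ Suc.prems[of k]] by simp
qed

text \<open>The two sides may live on different sample spaces: this transfers the solution to the
  product space of the first \<open>k\<close> noise values.\<close>

lemma solution_cong:
  "(\<And>i. i < k \<Longrightarrow> w i \<omega> = w' i \<omega>') \<Longrightarrow> solution S x0 u w k \<omega> = solution S x0 u w' k \<omega>'"
  by (induction k) auto

section \<open>Independence and integration over product laws\<close>

text \<open>Push the product law of \<open>(X, Y)\<close> forward along \<open>f\<close> and
  \<open>g\<close>. The conclusion is an equality of laws, which lets \<open>f\<close> and
  \<open>g\<close> map into different types, as they do below for the past and the noise.\<close>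

lemma (in prob_space) distr_pair_compose_indep_var:
  assumes ind: "indep_var M1 X M2 Y" and f: "f \<in> M1 \<rightarrow>\<^sub>M N1" and g: "g \<in> M2 \<rightarrow>\<^sub>M N2"
  shows "distr M (N1 \<Otimes>\<^sub>M N2) (\<lambda>\<omega>. (f (X \<omega>), g (Y \<omega>)))
       = distr M N1 (\<lambda>\<omega>. f (X \<omega>)) \<Otimes>\<^sub>M distr M N2 (\<lambda>\<omega>. g (Y \<omega>))"
proof -
  note [measurable] = indep_var_rv1[OF ind] indep_var_rv2[OF ind] f g
  interpret G: prob_space "distr M N2 (\<lambda>\<omega>. g (Y \<omega>))"
    by (rule prob_space_distr) measurable
  have f_distr: "distr M N1 (\<lambda>\<omega>. f (X \<omega>)) = distr (distr M M1 X) N1 f"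
    by (subst distr_distr) (auto simp: comp_def)
  have g_distr: "distr M N2 (\<lambda>\<omega>. g (Y \<omega>)) = distr (distr M M2 Y) N2 g"
    by (subst distr_distr) (auto simp: comp_def)
  have "distr M N1 (\<lambda>\<omega>. f (X \<omega>)) \<Otimes>\<^sub>M distr M N2 (\<lambda>\<omega>. g (Y \<omega>))
      = distr (distr M M1 X \<Otimes>\<^sub>M distr M M2 Y) (N1 \<Otimes>\<^sub>M N2) (\<lambda>(x, y). (f x, g y))"
    using G.sigma_finite_measure_axioms unfolding f_distr g_distr
    by (intro pair_measure_distr) auto
  also have "distr M M1 X \<Otimes>\<^sub>M distr M M2 Y = distr M (M1 \<Otimes>\<^sub>M M2) (\<lambda>\<omega>. (X \<omega>, Y \<omega>))"
    using ind by (simp add: indep_var_distribution_eq)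
  also have "distr \<dots> (N1 \<Otimes>\<^sub>M N2) (\<lambda>(x, y). (f x, g y))
      = distr M (N1 \<Otimes>\<^sub>M N2) (\<lambda>\<omega>. (f (X \<omega>), g (Y \<omega>)))"
    by (subst distr_distr) (auto simp: comp_def)
  finally show ?thesis by simp
qed

text \<open>Tonelli on the joint law. This takes the place of conditional expectation given
  \<open>X\<close>: the value of \<open>X\<close> is frozen and \<open>Y\<close> alone is
  averaged.\<close>

lemma (in prob_space) nn_integral_distr_pair:
  assumes rv [measurable]: "random_variable M1 X" "random_variable M2 Y"
    and joint: "distr M (M1 \<Otimes>\<^sub>M M2) (\<lambda>\<omega>. (X \<omega>, Y \<omega>)) = distr M M1 X \<Otimes>\<^sub>M distr M M2 Y"
    and g: "g \<in> borel_measurable (M1 \<Otimes>\<^sub>M M2)"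
  shows "(\<integral>\<^sup>+\<omega>. g (X \<omega>, Y \<omega>) \<partial>M) = (\<integral>\<^sup>+\<omega>. (\<integral>\<^sup>+y. g (X \<omega>, y) \<partial>distr M M2 Y) \<partial>M)"
proof -
  interpret Y: prob_space "distr M M2 Y" by (rule prob_space_distr) fact
  have gY: "g \<in> borel_measurable (N \<Otimes>\<^sub>M distr M M2 Y)" if "sets N = sets M1" for N
    using g that by (subst measurable_cong_sets[OF sets_pair_measure_cong refl]) auto
  have "(\<integral>\<^sup>+\<omega>. g (X \<omega>, Y \<omega>) \<partial>M) = (\<integral>\<^sup>+p. g p \<partial>distr M (M1 \<Otimes>\<^sub>M M2) (\<lambda>\<omega>. (X \<omega>, Y \<omega>)))"
    using g by (subst nn_integral_distr) auto
  also have "\<dots> = (\<integral>\<^sup>+x. (\<integral>\<^sup>+y. g (x, y) \<partial>distr M M2 Y) \<partial>distr M M1 X)"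
    unfolding joint by (subst Y.nn_integral_fst[symmetric]) (auto intro: gY)
  also have "\<dots> = (\<integral>\<^sup>+\<omega>. (\<integral>\<^sup>+y. g (X \<omega>, y) \<partial>distr M M2 Y) \<partial>M)"
    by (intro nn_integral_distr rv Y.borel_measurable_nn_integral_fst gY) simp
  finally show ?thesis .
qed

text \<open>The almost-sure counterpart, by Fubini for null sets. It will turn invariance of the
  state set along paths into a statement about almost every noise value at a frozen history.\<close>

lemma (in prob_space) AE_distr_pair:
  assumes rv [measurable]: "random_variable M1 X" "random_variable M2 Y"
    and joint: "distr M (M1 \<Otimes>\<^sub>M M2) (\<lambda>\<omega>. (X \<omega>, Y \<omega>)) = distr M M1 X \<Otimes>\<^sub>M distr M M2 Y"
    and A: "A \<in> sets (M1 \<Otimes>\<^sub>M M2)"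
    and ae: "AE \<omega> in M. (X \<omega>, Y \<omega>) \<in> A"
  shows "AE \<omega> in M. AE y in distr M M2 Y. (X \<omega>, y) \<in> A"
proof -
  interpret X: prob_space "distr M M1 X" by (rule prob_space_distr) fact
  interpret Y: prob_space "distr M M2 Y" by (rule prob_space_distr) fact
  interpret XY: pair_sigma_finite "distr M M1 X" "distr M M2 Y" ..
  have pred: "{p \<in> space (M1 \<Otimes>\<^sub>M M2). p \<in> A} \<in> sets (M1 \<Otimes>\<^sub>M M2)"
    using A by simp
  have "AE p in distr M M1 X \<Otimes>\<^sub>M distr M M2 Y. p \<in> A"
    unfolding joint[symmetric] using ae pred by (subst AE_distr_iff) auto
  then have "AE x in distr M M1 X. AE y in distr M M2 Y. (x, y) \<in> A"
    by (rule XY.AE_pair)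
  then show ?thesis
    by (rule AE_distrD[OF rv(1)])
qed

section \<open>One-step estimate and Markov's inequality\<close>

text \<open>Passes from the Bochner integral in the certificate condition to the nonnegative
  integral. They agree because the integrand is integrable and almost surely nonnegative, so
  \<open>ennreal\<close> truncates nothing of positive measure.\<close>

lemma nn_integral_form_next_le:
  fixes S :: "('n::finite, 'm::finite) delay_system"
  assumes N: "prob_space (std_normal_vec :: (real^'n) measure)"
    and B: "B = krasovskii_form (delay S) P P1"
    and nonneg: "AE v in std_normal_vec. 0 \<le> B (next_history S \<xi> a v)"
    and le: "expected_next S B \<xi> a \<le> c"
  shows "(\<integral>\<^sup>+v. ennreal (B (next_history S \<xi> a v)) \<partial>std_normal_vec) \<le> ennreal c"
proof -
  interpret N: prob_space "std_normal_vec :: (real^'n) measure" by fact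
  have "integrable std_normal_vec (\<lambda>v. B (next_history S \<xi> a v))"
    unfolding B by (rule integrable_krasovskii_form_next) unfold_locales
  then show ?thesis
    using nonneg le by (subst nn_integral_eq_integral) (auto simp: expected_next_def ennreal_leI)
qed

lemma (in prob_space) prob_le_of_nn_integral:
  assumes A: "A \<in> events" and c: "0 < c" and d: "0 \<le> d"
    and f: "\<And>\<omega>. \<omega> \<in> A \<Longrightarrow> ennreal c \<le> f \<omega>" and le: "(\<integral>\<^sup>+\<omega>. f \<omega> \<partial>M) \<le> ennreal d"
  shows "prob A \<le> d / c"
proof -
  have "ennreal (c * prob A) = (\<integral>\<^sup>+\<omega>. ennreal c * indicator A \<omega> \<partial>M)"
    using A c by (simp add: nn_integral_cmult_indicator emeasure_eq_measure ennreal_mult)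
  also have "\<dots> \<le> (\<integral>\<^sup>+\<omega>. f \<omega> \<partial>M)"
    by (intro nn_integral_mono) (auto simp: indicator_def f)
  also note le
  finally show ?thesis
    using c d by (simp add: field_simps)
qed

section \<open>The stopped certificate process and its drift\<close>

text \<open>The range starts at 1, as in the event to be bounded, so the flag holds vacuously at
  time 0.\<close>

definition safe_until ::
    "('n::finite, 'm::finite) delay_system \<Rightarrow> (real^'n) set \<Rightarrow> 'n history \<Rightarrow>
     (nat \<Rightarrow> 'n history \<Rightarrow> real^'m) \<Rightarrow> (nat \<Rightarrow> 'w \<Rightarrow> real^'n) \<Rightarrow> nat \<Rightarrow> 'w \<Rightarrow> bool" where
  "safe_until S Xb x0 u w k \<omega> \<longleftrightarrow> (\<forall>j\<in>{1..k}. solution S x0 u w j \<omega> \<notin> unsafe_histories S Xb)"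

lemma measurable_safe_until:
  assumes S: "dt_SNPS_td S" and u: "control_policy S u" and Xb: "Xb \<in> sets borel"
    and x0: "x0 \<in> space (\<Pi>\<^sub>M i\<in>{..delay S}. borel)"
    and w: "\<And>i. i < k \<Longrightarrow> w i \<in> borel_measurable M"
  shows "safe_until S Xb x0 u w k \<in> M \<rightarrow>\<^sub>M count_space UNIV"
proof -
  have "solution S x0 u w j \<in> M \<rightarrow>\<^sub>M (\<Pi>\<^sub>M i\<in>{..delay S}. borel)" if "j \<le> k" for j
    using that by (intro measurable_solution[OF S u x0] w) simp
  moreover have "unsafe_histories S Xb \<in> sets (\<Pi>\<^sub>M i\<in>{..delay S}. borel)"
    using S Xb by (intro sets_unsafe_histories) (simp add: dt_SNPS_td_def)
  ultimately have "Measurable.pred M (\<lambda>\<omega>. solution S x0 u w j \<omega> \<notin> unsafe_histories S Xb)"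
    if "j \<in> {1..k}" for j
    using that by (intro pred_intros_logic(2) pred_sets2) auto
  then show ?thesis
    unfolding safe_until_def by (intro pred_intros_finite(3)) auto
qed

text \<open>History and flag at time \<open>k\<close> are functions of the noises with index below
  \<open>k\<close>; the disjoint index blocks \<open>{..<k}\<close> and \<open>{k}\<close> of an
  independent family are independent.\<close>

lemma distr_pair_solution_noise:
  fixes S :: "('n::finite, 'm::finite) delay_system" and w :: "nat \<Rightarrow> 'w \<Rightarrow> real^'n"
  assumes "prob_space M"
    and S: "dt_SNPS_td S" and u: "control_policy S u" and Xb: "Xb \<in> sets borel"
    and x0: "x0 \<in> space (\<Pi>\<^sub>M i\<in>{..delay S}. borel)"
    and w: "prob_space.indep_vars M (\<lambda>_. borel) w UNIV"
  shows "distr M (((\<Pi>\<^sub>M i\<in>{..delay S}. borel) \<Otimes>\<^sub>M count_space UNIV) \<Otimes>\<^sub>M borel)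
      (\<lambda>\<omega>. ((solution S x0 u w k \<omega>, safe_until S Xb x0 u w k \<omega>), w k \<omega>))
    = distr M ((\<Pi>\<^sub>M i\<in>{..delay S}. borel) \<Otimes>\<^sub>M count_space UNIV)
        (\<lambda>\<omega>. (solution S x0 u w k \<omega>, safe_until S Xb x0 u w k \<omega>)) \<Otimes>\<^sub>M distr M borel (w k)"
proof -
  interpret prob_space M by fact
  \<comment> \<open>Coordinate projections serve as the noise on the product space, so running the
    same recursion there yields the past as a function of the first \<open>k\<close> noise
    values.\<close>
  let ?w = "\<lambda>i y. y i :: real^'n"
  let ?past = "\<lambda>y. (solution S x0 u ?w k y, safe_until S Xb x0 u ?w k y)"
  have ind: "indep_var (\<Pi>\<^sub>M i\<in>{..<k}. borel) (\<lambda>\<omega>. \<lambda>i\<in>{..<k}. w i \<omega>)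
      (\<Pi>\<^sub>M i\<in>{k}. borel) (\<lambda>\<omega>. \<lambda>i\<in>{k}. w i \<omega>)"
    by (rule indep_var_restrict[OF w]) auto
  have w_meas: "?w i \<in> borel_measurable (\<Pi>\<^sub>M i\<in>{..<k}. borel)" if "i < k" for i
    using that by (intro measurable_component_singleton) simp
  have past: "?past \<in> (\<Pi>\<^sub>M i\<in>{..<k}. borel) \<rightarrow>\<^sub>M (\<Pi>\<^sub>M i\<in>{..delay S}. borel) \<Otimes>\<^sub>M count_space UNIV"
    by (intro measurable_Pair measurable_solution[OF S u x0] measurable_safe_until[OF S u Xb x0] w_meas)
  have present: "(\<lambda>y. y k) \<in> (\<Pi>\<^sub>M i\<in>{k}. borel) \<rightarrow>\<^sub>M (borel :: (real^'n) measure)"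
    by (intro measurable_component_singleton) simp
  \<comment> \<open>All times up to \<open>k\<close> are covered because the flag inspects every
    earlier history.\<close>
  have past_eq: "solution S x0 u ?w j (\<lambda>i\<in>{..<k}. w i \<omega>) = solution S x0 u w j \<omega>"
    if "j \<le> k" for j \<omega>
    using that by (intro solution_cong) auto
  then have "?past (\<lambda>i\<in>{..<k}. w i \<omega>) = (solution S x0 u w k \<omega>, safe_until S Xb x0 u w k \<omega>)" for \<omega>
    by (auto simp: safe_until_def)
  then show ?thesis
    using distr_pair_compose_indep_var[OF ind past present] by simp
qed

definition stopped_certificate ::
    "('n::finite, 'm::finite) delay_system \<Rightarrow> (real^'n) set \<Rightarrow> real \<Rightarrow> ('n history \<Rightarrow> real) \<Rightarrow>
     'n history \<Rightarrow> (nat \<Rightarrow> 'n history \<Rightarrow> real^'m) \<Rightarrow> (nat \<Rightarrow> 'w \<Rightarrow> real^'n) \<Rightarrow> nat \<Rightarrow> 'w \<Rightarrow> ennreal" where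
  "stopped_certificate S Xb \<gamma>b B x0 u w k \<omega> =
     (if safe_until S Xb x0 u w k \<omega> then ennreal (B (solution S x0 u w k \<omega>)) else ennreal \<gamma>b)"

text \<open>Old and new flag differ only on a first entry at time \<open>Suc k\<close>, where
  \<open>B\<close> is at least \<open>\<gamma>b\<close>. The bound uses the old flag, which is
  settled before \<open>w k\<close> is drawn.\<close>

lemma stopped_certificate_Suc_le:
  assumes "\<And>\<xi>. \<xi> \<in> unsafe_histories S Xb \<Longrightarrow> \<gamma>b \<le> B \<xi>"
  shows "stopped_certificate S Xb \<gamma>b B x0 u w (Suc k) \<omega> \<le>
    (if safe_until S Xb x0 u w k \<omega> then ennreal (B (solution S x0 u w (Suc k) \<omega>)) else ennreal \<gamma>b)"
  using assms
  by (auto simp: stopped_certificate_def safe_until_def atLeastAtMostSuc_conv intro!: ennreal_leI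
      simp del: solution.simps)

text \<open>Freeze the past and average over \<open>w k\<close>: while safe, the third certificate
  condition adds at most \<open>\<eta>\<close>; once stopped, the value is constant.\<close>

lemma nn_integral_stopped_certificate_Suc_le:
  fixes S :: "('n::finite, 'm::finite) delay_system" and w :: "nat \<Rightarrow> 'w \<Rightarrow> real^'n"
  assumes "prob_space M"
    and S: "dt_SNPS_td S" and Xb: "Xb \<in> sets borel"
    and u: "control_policy S u" and w: "std_normal_noise M w"
    and x0: "x0 \<in> space (\<Pi>\<^sub>M i\<in>{..delay S}. borel)"
    and B: "B = krasovskii_form (delay S) P P1"
    and nonneg: "\<And>\<xi>. \<xi> \<in> histories (delay S) (state_set S) \<Longrightarrow> 0 \<le> B \<xi>"
    and unsafe: "\<And>\<xi>. \<xi> \<in> unsafe_histories S Xb \<Longrightarrow> \<gamma>b \<le> B \<xi>"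
    and \<eta>: "0 \<le> \<eta>"
    and step: "\<And>\<xi>. \<xi> \<in> histories (delay S) (state_set S) \<Longrightarrow>
      expected_next S B \<xi> (u k \<xi>) - B \<xi> \<le> \<eta>"
    and inv: "\<And>k. AE \<omega> in M. solution S x0 u w k \<omega> \<in> histories (delay S) (state_set S)"
  shows "(\<integral>\<^sup>+\<omega>. stopped_certificate S Xb \<gamma>b B x0 u w (Suc k) \<omega> \<partial>M)
       \<le> (\<integral>\<^sup>+\<omega>. stopped_certificate S Xb \<gamma>b B x0 u w k \<omega> \<partial>M) + ennreal \<eta>"
proof -
  interpret prob_space M by fact
  let ?H = "\<Pi>\<^sub>M i\<in>{..delay S}. borel :: (real^'n) measure"
  let ?Hs = "histories (delay S) (state_set S)"
  let ?N = "std_normal_vec :: (real^'n) measure"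
  let ?X = "solution S x0 u w k" and ?A = "safe_until S Xb x0 u w k"
  let ?next = "\<lambda>\<xi> v. next_history S \<xi> (u k \<xi>) v"
  have X: "state_set S \<in> sets borel"
    using S by (simp add: dt_SNPS_td_def)
  have indep: "indep_vars (\<lambda>_. borel) w UNIV" and distr: "distr M borel (w k) = ?N"
    using w by (auto simp: std_normal_noise_def)
  have w_meas [measurable]: "w i \<in> borel_measurable M" for i
    using indep by (auto simp: indep_vars_def)
  have N: "prob_space ?N"
    unfolding distr[symmetric] by (rule prob_space_distr) measurable
  have joint: "distr M ((?H \<Otimes>\<^sub>M count_space UNIV) \<Otimes>\<^sub>M borel) (\<lambda>\<omega>. ((?X \<omega>, ?A \<omega>), w k \<omega>))
      = distr M (?H \<Otimes>\<^sub>M count_space UNIV) (\<lambda>\<omega>. (?X \<omega>, ?A \<omega>)) \<Otimes>\<^sub>M distr M borel (w k)"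
    by (rule distr_pair_solution_noise[OF \<open>prob_space M\<close> S u Xb x0 indep])
  have fst_meas: "(\<lambda>p. fst (fst p)) \<in> (?H \<Otimes>\<^sub>M count_space (UNIV :: bool set)) \<Otimes>\<^sub>M borel \<rightarrow>\<^sub>M ?H"
    by measurable
  have next_meas [measurable]: "(\<lambda>p. ?next (fst (fst p)) (snd p))
      \<in> (?H \<Otimes>\<^sub>M count_space (UNIV :: bool set)) \<Otimes>\<^sub>M borel \<rightarrow>\<^sub>M ?H"
    by (intro measurable_next_history[OF S fst_meas]
        measurable_compose[OF fst_meas measurable_control_policy[OF u X]]) measurable
  have B_meas [measurable]: "B \<in> borel_measurable ?H"
    unfolding B by (rule measurable_krasovskii_form)
  have Hs [measurable]: "?Hs \<in> sets ?H"
    by (rule sets_histories[OF X])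
  have sol_meas [measurable]: "?X \<in> M \<rightarrow>\<^sub>M ?H"
    by (rule measurable_solution[OF S u x0]) measurable
  have safe_meas [measurable]: "Measurable.pred M ?A"
    by (rule measurable_safe_until[OF S u Xb x0]) measurable

  have XA_meas: "(\<lambda>\<omega>. (?X \<omega>, ?A \<omega>)) \<in> M \<rightarrow>\<^sub>M ?H \<Otimes>\<^sub>M count_space UNIV"
    by measurable

  \<comment> \<open>The upper bound with the old flag, as a function of past and noise, ready for
    Tonelli.\<close>
  define g where "g p = (if snd (fst p) then ennreal (B (?next (fst (fst p)) (snd p))) else ennreal \<gamma>b)"
    for p :: "('n history \<times> bool) \<times> (real^'n)"
  have g: "g \<in> borel_measurable ((?H \<Otimes>\<^sub>M count_space UNIV) \<Otimes>\<^sub>M borel)"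
    unfolding g_def by measurable
  \<comment> \<open>\<open>Q\<close> encodes that the step stays in the state set. Invariance at
    \<open>Suc k\<close> puts the actual pair in \<open>Q\<close> almost surely, hence almost every
    noise value at a frozen past keeps \<open>B\<close> nonnegative.\<close>
  define Q where "Q = {p \<in> space ((?H \<Otimes>\<^sub>M count_space (UNIV :: bool set)) \<Otimes>\<^sub>M (borel :: (real^'n) measure)).
    ?next (fst (fst p)) (snd p) \<in> ?Hs}"
  have Q: "Q \<in> sets ((?H \<Otimes>\<^sub>M count_space UNIV) \<Otimes>\<^sub>M borel)"
    unfolding Q_def by measurable
  have "AE \<omega> in M. ((?X \<omega>, ?A \<omega>), w k \<omega>) \<in> Q"
    using inv[of "Suc k"] AE_space
    by eventually_elim
       (auto simp: Q_def space_pair_measure dest: measurable_space[OF sol_meas])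
  then have "AE \<omega> in M. AE v in ?N. ((?X \<omega>, ?A \<omega>), v) \<in> Q"
    using AE_distr_pair[OF XA_meas w_meas joint Q] unfolding distr by blast
  with inv[of k] have bound: "AE \<omega> in M. (\<integral>\<^sup>+v. g ((?X \<omega>, ?A \<omega>), v) \<partial>?N)
      \<le> stopped_certificate S Xb \<gamma>b B x0 u w k \<omega> + ennreal \<eta>"
  proof eventually_elim
    case (elim \<omega>)
    interpret N: prob_space ?N by (rule N)
    show ?case
    proof (cases "?A \<omega>")
      case True
      have "AE v in ?N. 0 \<le> B (?next (?X \<omega>) v)"
        using elim(2) by eventually_elim (auto simp: Q_def intro: nonneg)
      moreover have "expected_next S B (?X \<omega>) (u k (?X \<omega>)) \<le> B (?X \<omega>) + \<eta>"
        using step[OF elim(1)] by simp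
      ultimately have "(\<integral>\<^sup>+v. ennreal (B (?next (?X \<omega>) v)) \<partial>?N) \<le> ennreal (B (?X \<omega>) + \<eta>)"
        by (rule nn_integral_form_next_le[OF N B])
      then show ?thesis
        using True \<eta> nonneg[OF elim(1)] by (simp add: g_def stopped_certificate_def)
    next
      case False
      then show ?thesis by (simp add: g_def stopped_certificate_def N.emeasure_space_1)
    qed
  qed

  have "(\<integral>\<^sup>+\<omega>. stopped_certificate S Xb \<gamma>b B x0 u w (Suc k) \<omega> \<partial>M)
      \<le> (\<integral>\<^sup>+\<omega>. g ((?X \<omega>, ?A \<omega>), w k \<omega>) \<partial>M)"
    \<comment> \<open>Evaluating \<open>g\<close> at the actual noise \<open>w k\<close> folds the
      next history back into the solution at \<open>Suc k\<close>.\<close>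
    unfolding g_def fst_conv snd_conv solution.simps(2)[symmetric]
    by (intro nn_integral_mono stopped_certificate_Suc_le unsafe)
  also have "\<dots> = (\<integral>\<^sup>+\<omega>. (\<integral>\<^sup>+v. g ((?X \<omega>, ?A \<omega>), v) \<partial>?N) \<partial>M)"
    using nn_integral_distr_pair[OF XA_meas w_meas joint g] unfolding distr .
  also have "\<dots> \<le> (\<integral>\<^sup>+\<omega>. stopped_certificate S Xb \<gamma>b B x0 u w k \<omega> + ennreal \<eta> \<partial>M)"
    by (rule nn_integral_mono_AE[OF bound])
  also have "\<dots> = (\<integral>\<^sup>+\<omega>. stopped_certificate S Xb \<gamma>b B x0 u w k \<omega> \<partial>M) + ennreal \<eta>"
    unfolding stopped_certificate_def by (subst nn_integral_add) (auto simp: emeasure_space_1)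
  finally show ?thesis .
qed

section \<open>The safety bound over the finite horizon\<close>

theorem proposition3p4:
  fixes S :: "('n::finite, 'm::finite) delay_system"
    and Xa Xb :: "(real^'n) set"
    and T :: nat
    and \<eta> \<gamma>a \<gamma>b :: real
    and B :: "'n history \<Rightarrow> real"
    and u :: "nat \<Rightarrow> 'n history \<Rightarrow> real^'m"
    and M :: "'w measure"
    and w :: "nat \<Rightarrow> 'w \<Rightarrow> real^'n"
    and x0 :: "'n history"
  assumes "dt_SNPS_td S"
    and "Xa \<subseteq> state_set S" and "Xb \<subseteq> state_set S" and "Xa \<inter> Xb = {}"
    and "Xb \<in> sets borel"
    and "K_QCBC S Xa Xb \<eta> \<gamma>a \<gamma>b B"
    and "control_policy S u"
    and "\<And>k \<xi>. \<xi> \<in> histories (delay S) (state_set S) \<Longrightarrow>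
           expected_next S B \<xi> (u k \<xi>) - B \<xi> \<le> \<eta>"
    and "prob_space M" and "std_normal_noise M w"
    and "x0 \<in> histories (delay S) Xa"
    and "AE \<omega> in M. \<forall>k. solution S x0 u w k \<omega> \<in> histories (delay S) (state_set S)"
  shows "\<P>(\<omega> in M. \<forall>k\<in>{1..T}. solution S x0 u w k \<omega> \<notin> unsafe_histories S Xb)
           \<ge> 1 - (\<gamma>a + \<eta> * real T) / \<gamma>b"
proof -
  interpret prob_space M by fact
  obtain P P1 where B: "B = krasovskii_form (delay S) P P1"
    and pos: "0 < \<eta>" "0 < \<gamma>a" "0 < \<gamma>b"
    and nonneg: "\<And>\<xi>. \<xi> \<in> histories (delay S) (state_set S) \<Longrightarrow> 0 \<le> B \<xi>"
    and init: "\<And>\<xi>. \<xi> \<in> histories (delay S) Xa \<Longrightarrow> B \<xi> \<le> \<gamma>a"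
    and unsafe: "\<And>\<xi>. \<xi> \<in> unsafe_histories S Xb \<Longrightarrow> \<gamma>b \<le> B \<xi>"
    using assms(6) unfolding K_QCBC_def by blast
  have x0: "x0 \<in> space (\<Pi>\<^sub>M i\<in>{..delay S}. borel)"
    using assms(11) by (auto simp: histories_def space_PiM PiE_iff)
  have inv: "AE \<omega> in M. solution S x0 u w k \<omega> \<in> histories (delay S) (state_set S)" for k
    using assms(12) by eventually_elim simp
  have bound: "(\<integral>\<^sup>+\<omega>. stopped_certificate S Xb \<gamma>b B x0 u w k \<omega> \<partial>M) \<le> ennreal (\<gamma>a + \<eta> * real k)" for k
  proof (induction k)
    case 0
    \<comment> \<open>The range \<open>{1..0}\<close> is empty, so the process starts at
      \<open>B x0\<close> and the first certificate condition applies.\<close>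
    have "stopped_certificate S Xb \<gamma>b B x0 u w 0 \<omega> \<le> ennreal \<gamma>a" for \<omega>
      using init[OF assms(11)] by (simp add: stopped_certificate_def safe_until_def ennreal_leI)
    then have "(\<integral>\<^sup>+\<omega>. stopped_certificate S Xb \<gamma>b B x0 u w 0 \<omega> \<partial>M) \<le> (\<integral>\<^sup>+\<omega>. ennreal \<gamma>a \<partial>M)"
      by (intro nn_integral_mono) auto
    then show ?case by (simp add: emeasure_space_1)
  next
    case (Suc k)
    have "(\<integral>\<^sup>+\<omega>. stopped_certificate S Xb \<gamma>b B x0 u w (Suc k) \<omega> \<partial>M)
        \<le> (\<integral>\<^sup>+\<omega>. stopped_certificate S Xb \<gamma>b B x0 u w k \<omega> \<partial>M) + ennreal \<eta>"
      using pos by (intro nn_integral_stopped_certificate_Suc_le[OF assms(9,1,5,7,10) x0 B nonneg unsafe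
          _ assms(8) inv]) auto
    also have "\<dots> \<le> ennreal (\<gamma>a + \<eta> * real k) + ennreal \<eta>"
      by (rule add_right_mono[OF Suc])
    also have "\<dots> = ennreal (\<gamma>a + \<eta> * real (Suc k))"
      using pos by (subst ennreal_plus[symmetric]) (auto simp: algebra_simps)
    finally show ?case .
  qed
  have w_meas: "w i \<in> borel_measurable M" for i
    using assms(10) by (auto simp: std_normal_noise_def indep_vars_def)
  have safe_meas [measurable]: "Measurable.pred M (safe_until S Xb x0 u w T)"
    by (rule measurable_safe_until[OF assms(1,7,5) x0 w_meas])
  \<comment> \<open>Markov at level \<open>\<gamma>b\<close>, the exact value of the stopped process
    on the complement of the safe event.\<close>
  have "\<P>(\<omega> in M. \<not> safe_until S Xb x0 u w T \<omega>) \<le> (\<gamma>a + \<eta> * real T) / \<gamma>b"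
    using pos by (intro prob_le_of_nn_integral[OF _ _ _ _ bound]) (auto simp: stopped_certificate_def)
  moreover have "\<P>(\<omega> in M. \<not> safe_until S Xb x0 u w T \<omega>) = 1 - \<P>(\<omega> in M. safe_until S Xb x0 u w T \<omega>)"
    by (rule prob_neg) measurable
  ultimately show ?thesis
    by (simp add: safe_until_def)
qed

end
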